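(* Let $(V,E^1)$ and $(V,E^2)$ be two graphs with the same set $V$ of $n$ vertices and with the same number of edges, $|E^1|=|E^2|$, and let the number of differing edges in $E^1$ and $E^2$ be equal to $l$, i.e. $l=|E^1\setminus E^2|=|E^2\setminus E^1|$. Then $$\sum_k |\lambda^1_k - \lambda^2_k| \leq n l,$$ where $\lambda^1_k$ and $\lambda^2_k$ are all elements of the Laplacian spectra of the graphs $(V,E^1)$ and $(V,E^2)$, respectively, in nonincreasing order.
   Context: Graphs are finite, simple (no self-loops, no multiple edges) and unweighted (edge weights take only the values $0$, meaning absent, and $1$, meaning present). $V=\{v_1,\ldots,v_n\}$ is a finite ordered set of vertices; the set $E_c$ of all possible edges consists of all $e_k=[v_i,v_j]$ with $i>j$; the edge set $E$ of a graph $(V,E)$ is a subset of $E_c$. The vertex–edge incidence matrix $Q$ of $(V,E)$ has a row for each vertex and a column for each edge in $E$; the column corresponding to $e_k=[v_i,v_j]$, $i>j$, has $q_{ik}=1$, $q_{jk}=-1$ and all other entries zero. The graph Laplacian is the $n\times n$ matrix $L=QQ^\ast$, and the Laplacian spectrum of the graph is the collection of all $n$ eigenvalues of $L$ counted with multiplicity. *)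

theory Defs
  imports "Jordan_Normal_Form.Char_Poly" "HOL-Computational_Algebra.Polynomial"
begin

text \<open>
  The vertices \<open>v\<^sub>1, \<dots>, v\<^sub>n\<close> are represented by \<open>0, \<dots>, n - 1\<close>, and the edge
  \<open>[v\<^sub>i, v\<^sub>j]\<close> with \<open>i > j\<close> by the pair \<open>(i, j)\<close>. The edge set of a graph on \<open>n\<close>
  vertices is an arbitrary subset of \<open>possible_edges n\<close>.
\<close>

definition possible_edges :: "nat \<Rightarrow> (nat \<times> nat) set" where
  "possible_edges n = {(i, j). j < i \<and> i < n}"

text \<open>
  The columns of the incidence matrix are ordered by an enumeration of all possible edges;
  the Laplacian does not depend on the choice of this enumeration.
\<close>

definition edge_list :: "nat \<Rightarrow> (nat \<times> nat) set \<Rightarrow> (nat \<times> nat) list" where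
  "edge_list n E = [(i, j). i \<leftarrow> [0..<n], j \<leftarrow> [0..<i], (i, j) \<in> E]"

definition incidence_matrix :: "nat \<Rightarrow> (nat \<times> nat) set \<Rightarrow> real mat" where
  "incidence_matrix n E = (let es = edge_list n E in
     mat n (length es) (\<lambda>(v, k).
       if v = fst (es ! k) then 1 else if v = snd (es ! k) then -1 else 0))"

definition laplacian :: "nat \<Rightarrow> (nat \<times> nat) set \<Rightarrow> real mat" where
  "laplacian n E = incidence_matrix n E * transpose_mat (incidence_matrix n E)"

text \<open>
  Eigenvalues are counted with their multiplicity as roots of the characteristic polynomial.
  Since the Laplacian is real symmetric, this multiset has exactly \<open>n\<close> elements.
\<close>

definition laplacian_spectrum :: "nat \<Rightarrow> (nat \<times> nat) set \<Rightarrow> real multiset" where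
  "laplacian_spectrum n E = proots (char_poly (laplacian n E))"

definition laplacian_eigenvalues :: "nat \<Rightarrow> (nat \<times> nat) set \<Rightarrow> real list" where
  "laplacian_eigenvalues n E = rev (sorted_list_of_multiset (laplacian_spectrum n E))"

lemma set_edge_list: "set (edge_list n E) = E \<inter> possible_edges n"
  by (auto simp: edge_list_def possible_edges_def)

lemma distinct_edge_list: "distinct (edge_list n E)"
proof -
  have inner: "distinct (concat (map (\<lambda>j. if (i, j) \<in> E then [(i, j)] else []) xs))"
    if "distinct xs" for i and xs :: "nat list"
    using that by (induction xs) (auto split: if_splits)
  have "distinct (concat (map (\<lambda>i. concat (map (\<lambda>j. if (i, j) \<in> E then [(i, j)] else [])
      [0..<i])) xs))" if "distinct xs" for xs :: "nat list"
    using that by (induction xs) (auto simp: inner split: if_splits)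
  then show ?thesis
    by (simp add: edge_list_def)
qed

end

theory Submission
  imports Defs
begin

text \<open>
  By Weyl's monotonicity principle, deleting edges does not increase any ordered Laplacian eigenvalue.
  Comparing both graphs with \<open>(V, E1 \<inter> E2)\<close>, and noting that an edge contributes \<open>2\<close> to the trace,
  gives the bound \<open>2 * l + 2 * l = 4 * l\<close>, which settles \<open>n \<ge> 4\<close>. For \<open>n \<le> 2\<close> necessarily \<open>l = 0\<close>.
  For \<open>n = 3\<close> the remaining case is \<open>l = 1\<close> with one or two edges in each graph; there the spectrum
  is nonnegative, bounded by \<open>3\<close>, contains \<open>0\<close> and has a prescribed sum, so each of the two largest
  eigenvalues varies by at most \<open>1\<close>.
\<close>

section \<open>The spectral theorem for real symmetric matrices\<close>

lemma symmetric_scalar_prod: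
  fixes A :: "'a::comm_semiring_1 mat"
  assumes A: "A \<in> carrier_mat n n" and sym: "A\<^sup>T = A"
    and x: "x \<in> carrier_vec n" and y: "y \<in> carrier_vec n"
  shows "x \<bullet> (A *\<^sub>v y) = y \<bullet> (A *\<^sub>v x)"
proof -
  have "y \<bullet> (A *\<^sub>v x) = (A\<^sup>T *\<^sub>v y) \<bullet> x"
    using transpose_vec_mult_scalar[OF A x y] sym by simp
  also have "\<dots> = x \<bullet> (A *\<^sub>v y)"
    unfolding sym using A x y by (intro comm_scalar_prod[of _ n]) auto
  finally show ?thesis ..
qed

text \<open>Since \<open>A\<close> is real, conjugating an eigenvector \<open>v\<close> entrywise
  gives an eigenvector \<open>w\<close> for \<open>cnj a\<close>. Symmetry moves \<open>A\<close>
  across the bilinear product \<open>w \<bullet> v\<close>, so \<open>a\<close> and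
  \<open>cnj a\<close> agree after multiplication by it; and \<open>w \<bullet> v\<close> is the
  squared norm of \<open>v\<close>, hence nonzero.\<close>

lemma symmetric_eigenvalue_real:
  fixes A :: "real mat"
  assumes A: "A \<in> carrier_mat n n" and sym: "A\<^sup>T = A"
    and ev: "eigenvalue (map_mat complex_of_real A) a"
  shows "Im a = 0"
proof -
  let ?C = "map_mat complex_of_real A"
  have C: "?C \<in> carrier_mat n n" using A by simp
  have symC: "?C\<^sup>T = ?C" using sym by (metis map_mat_transpose)
  obtain v where v: "v \<in> carrier_vec n" "v \<noteq> 0\<^sub>v n" and Cv: "?C *\<^sub>v v = a \<cdot>\<^sub>v v"
    using ev A unfolding eigenvalue_def eigenvector_def by auto
  define w where "w = map_vec cnj v"
  have w: "w \<in> carrier_vec n" using v by (simp add: w_def)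
  have Cw: "?C *\<^sub>v w = cnj a \<cdot>\<^sub>v w"
  proof (rule eq_vecI)
    fix i assume i: "i < dim_vec (cnj a \<cdot>\<^sub>v w)"
    then have i: "i < n" using w by simp
    have "(?C *\<^sub>v w) $ i = cnj ((?C *\<^sub>v v) $ i)"
      using A v i by (auto simp: scalar_prod_def w_def)
    then show "(?C *\<^sub>v w) $ i = (cnj a \<cdot>\<^sub>v w) $ i"
      using i v by (simp add: Cv w_def)
  qed (use A w in auto)
  have "a * (w \<bullet> v) = w \<bullet> (?C *\<^sub>v v)"
    using v w by (simp add: Cv)
  also have "\<dots> = v \<bullet> (?C *\<^sub>v w)"
    by (rule symmetric_scalar_prod[OF C symC w v(1)])
  also have "\<dots> = cnj a * (w \<bullet> v)"
    using v w by (simp add: Cw comm_scalar_prod[of v n w])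
  finally have eq: "a * (w \<bullet> v) = cnj a * (w \<bullet> v)" .
  have "w \<bullet> v = of_real (\<Sum>i<n. (cmod (v $ i))\<^sup>2)"
    using v by (auto simp: scalar_prod_def w_def complex_norm_square mult.commute
        atLeast0LessThan intro!: sum.cong simp del: of_real_power)
  moreover obtain i where "i < n" "v $ i \<noteq> 0"
    using v by (metis carrier_vecD eq_vecI index_zero_vec(1) index_zero_vec(2))
  then have "(\<Sum>i<n. (cmod (v $ i))\<^sup>2) > 0"
    by (intro sum_pos2[of _ i]) auto
  ultimately have "w \<bullet> v \<noteq> 0" by (simp del: of_real_sum of_real_power)
  with eq have "a = cnj a" by simp
  then show ?thesis by (simp add: complex_eq_iff)
qed

text \<open>The polynomial factors over the complex numbers, every root is an eigenvalue and
  therefore real, and injectivity of the embedding of the reals carries the factorization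
  back.\<close>

lemma char_poly_symmetric_splits:
  fixes A :: "real mat"
  assumes A: "A \<in> carrier_mat n n" and sym: "A\<^sup>T = A"
  obtains es where "char_poly A = (\<Prod>e\<leftarrow>es. [:- e, 1:])"
proof -
  interpret hp: map_poly_inj_comm_ring_hom complex_of_real ..
  let ?C = "map_mat complex_of_real A"
  have C: "?C \<in> carrier_mat n n" using A by simp
  obtain as where as: "char_poly ?C = (\<Prod>a\<leftarrow>as. [:- a, 1:])"
    using char_poly_factorized[OF C] by auto
  have real: "of_real (Re a) = a" if "a \<in> set as" for a
  proof -
    have "poly (char_poly ?C) a = 0"
      unfolding as using that by (rule linear_poly_root)
    then have "eigenvalue ?C a" by (simp add: eigenvalue_root_char_poly[OF C])
    then have "Im a = 0" by (rule symmetric_eigenvalue_real[OF A sym])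
    then show ?thesis by (simp add: complex_eq_iff)
  qed
  have "map_poly complex_of_real (\<Prod>e\<leftarrow>map Re as. [:- e, 1:])
      = (\<Prod>a\<leftarrow>as. [:- of_real (Re a), 1:])"
    by (simp add: hp.hom_prod_list o_def)
  also have "\<dots> = (\<Prod>a\<leftarrow>as. [:- a, 1:])"
    using real by (intro arg_cong[of _ _ prod_list] map_cong) auto
  also have "\<dots> = map_poly complex_of_real (char_poly A)"
    by (simp add: as[symmetric] of_real_hom.char_poly_hom[OF A])
  finally have "char_poly A = (\<Prod>e\<leftarrow>map Re as. [:- e, 1:])"
    by (simp del: map_map)
  then show ?thesis by (rule that)
qed

text \<open>Completes a unit vector to an orthonormal basis; the spectral theorem uses it to split
  off one eigenvector.\<close>

lemma orthogonal_matrix_with_first_column: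
  fixes v :: "real vec"
  assumes v: "v \<in> carrier_vec n" and v1: "v \<bullet> v = 1" and n: "n > 0"
  obtains W where "W \<in> carrier_mat n n" "W\<^sup>T * W = 1\<^sub>m n" "col W 0 = v"
proof (cases "v = unit_vec n 0")
  case True
  show ?thesis by (rule that[of "1\<^sub>m n"]) (use n True in auto)
next
  case False
  \<comment> \<open>The Householder reflection exchanging \<open>v\<close> and the first unit vector.\<close>
  define u where "u = v - unit_vec n 0"
  have u: "u \<in> carrier_vec n" using v by (simp add: u_def)
  have u_nth: "u $ i = v $ i - (if i = 0 then 1 else 0)" if "i < n" for i
    using that v by (simp add: u_def unit_vec_def)
  have sumv: "(\<Sum>i<n. (v $ i)\<^sup>2) = 1"
    using v1 v by (simp add: scalar_prod_def power2_eq_square atLeast0LessThan)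
  define s where "s = (\<Sum>i<n. (u $ i)\<^sup>2)"
  have "s = (\<Sum>i<n. (v $ i)\<^sup>2 + (if i = 0 then 1 - 2 * v $ i else 0))"
    unfolding s_def by (intro sum.cong) (auto simp: u_nth power2_eq_square algebra_simps)
  then have s: "s = 2 - 2 * v $ 0"
    using n by (simp add: sum.distrib sumv sum.delta)
  have "s \<noteq> 0"
  proof
    assume "s = 0"
    then have "u $ i = 0" if "i < n" for i
      using that unfolding s_def by (simp add: sum_nonneg_eq_0_iff)
    then have "v = unit_vec n 0"
      using v u_nth by (intro eq_vecI) (auto simp: unit_vec_def)
    with False show False by simp
  qed
  \<comment> \<open>In \<open>W\<^sup>T * W\<close> the rank-one terms carry the factor
    \<open>c * s - 2\<close>, so this choice of \<open>c\<close> makes \<open>W\<close>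
    orthogonal.\<close>
  define c where "c = 2 / s"
  have cs: "c * s = 2" using \<open>s \<noteq> 0\<close> by (simp add: c_def)
  let ?d = "\<lambda>i j. if i = j then 1 else 0 :: real"
  define W where "W = mat n n (\<lambda>(i, j). ?d i j - c * u $ i * u $ j)"
  have W: "W \<in> carrier_mat n n" by (simp add: W_def)
  moreover have "W\<^sup>T * W = 1\<^sub>m n"
  proof (rule eq_matI)
    fix i j assume "i < dim_row (1\<^sub>m n :: real mat)" "j < dim_col (1\<^sub>m n :: real mat)"
    then have ij: "i < n" "j < n" by auto
    have "(W\<^sup>T * W) $$ (i, j)
        = (\<Sum>k<n. (?d k i - c * u $ k * u $ i) * (?d k j - c * u $ k * u $ j))"
      using ij by (simp add: W_def scalar_prod_def atLeast0LessThan)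
    also have "\<dots> = (\<Sum>k<n. (if k = i then ?d i j - c * u $ i * u $ j else 0)
        - (if k = j then c * u $ i * u $ j else 0) + (u $ k)\<^sup>2 * (c\<^sup>2 * u $ i * u $ j))"
      by (intro sum.cong) (auto simp: algebra_simps power2_eq_square)
    also have "\<dots> = ?d i j - 2 * (c * u $ i * u $ j) + s * (c\<^sup>2 * u $ i * u $ j)"
      using ij by (simp add: sum.distrib sum_subtractf sum.delta s_def sum_distrib_right)
    also have "\<dots> = ?d i j + (c * s - 2) * (c * u $ i * u $ j)"
      by (simp add: algebra_simps power2_eq_square)
    finally show "(W\<^sup>T * W) $$ (i, j) = 1\<^sub>m n $$ (i, j)"
      using ij by (simp add: cs)
  qed (use W in auto)
  moreover have "col W 0 = v"
  proof (rule eq_vecI)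
    fix i assume "i < dim_vec v"
    then have i: "i < n" using v by simp
    \<comment> \<open>As \<open>s = 2 * (1 - v $ 0)\<close>, the first column of \<open>W\<close> is
      the first unit vector plus \<open>u\<close>, which is \<open>v\<close>.\<close>
    have "c * (1 - v $ 0) = 1" using cs s by (simp add: algebra_simps)
    then have "c * u $ 0 = - 1" using n by (simp add: u_nth algebra_simps)
    moreover have "col W 0 $ i = ?d i 0 - (c * u $ 0) * u $ i"
      using i n by (simp add: W_def)
    ultimately show "col W 0 $ i = v $ i"
      using i by (simp add: u_nth)
  qed (use v in \<open>simp add: W_def\<close>)
  ultimately show ?thesis by (rule that)
qed

text \<open>Deflation: an orthogonal change of basis whose first vector is a unit eigenvector for
  \<open>e\<close> turns \<open>A\<close> into a block diagonal matrix with blocks \<open>e\<close>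
  and \<open>A3\<close>, and induction applies to \<open>A3\<close>. The list \<open>es\<close>
  prescribes the order of the diagonal, so a sorted diagonalization can be requested later.\<close>

theorem real_spectral_theorem:
  fixes A :: "real mat"
  assumes "A \<in> carrier_mat n n" and "A\<^sup>T = A"
    and "char_poly A = (\<Prod>e\<leftarrow>es. [:- e, 1:])"
  shows "\<exists>P \<in> carrier_mat n n. P\<^sup>T * P = 1\<^sub>m n \<and> A = P * mat_diag n ((!) es) * P\<^sup>T"
  using assms
proof (induction es arbitrary: n A)
  case Nil
  then have "n = 0" using degree_monic_char_poly[of A n] by simp
  then show ?case using Nil by (intro bexI[of _ "1\<^sub>m 0"]) (auto intro!: eq_matI)
next
  case (Cons e es n A)
  note A = Cons.prems(1) and sym = Cons.prems(2) and cp = Cons.prems(3)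
  have "eigenvalue A e"
    by (simp add: eigenvalue_root_char_poly[OF A] cp)
  then obtain v0 where v0: "v0 \<in> carrier_vec n" "v0 \<noteq> 0\<^sub>v n" and Av0: "A *\<^sub>v v0 = e \<cdot>\<^sub>v v0"
    using A unfolding eigenvalue_def eigenvector_def by auto
  have pos: "v0 \<bullet> v0 > 0"
    using v0 conjugate_square_greater_0_vec[of v0 n] by simp
  define v where "v = (1 / sqrt (v0 \<bullet> v0)) \<cdot>\<^sub>v v0"
  have v: "v \<in> carrier_vec n" using v0 by (simp add: v_def)
  have v1: "v \<bullet> v = 1" using v0 pos by (simp add: v_def)
  have Av: "A *\<^sub>v v = e \<cdot>\<^sub>v v"
    using A v0 by (simp add: v_def mult_mat_vec[OF A v0(1)] Av0 smult_smult_assoc mult.commute)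
  have "n > 0" using v0 by (cases n) auto
  then obtain m where n: "n = Suc m" by (cases n) auto
  obtain W where W: "W \<in> carrier_mat n n" and WW: "W\<^sup>T * W = 1\<^sub>m n" and W0: "col W 0 = v"
    using orthogonal_matrix_with_first_column[OF v v1 \<open>n > 0\<close>] .
  have WW': "W * W\<^sup>T = 1\<^sub>m n"
    by (rule mat_mult_left_right_inverse[OF _ W WW]) (use W in auto)
  define B where "B = W\<^sup>T * A * W"
  have B: "B \<in> carrier_mat n n" using W A by (simp add: B_def)
  have A_eq: "A = W * B * W\<^sup>T"
  proof -
    have "W * B * W\<^sup>T = (W * W\<^sup>T) * A * (W * W\<^sup>T)"
      unfolding B_def using A W by (simp add: assoc_mult_mat[of _ n n _ n _ n])
    then show ?thesis using A by (simp add: WW')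
  qed
  have symB: "B\<^sup>T = B"
    unfolding B_def using A W sym
    by (simp add: transpose_mult[of _ n n _ n] assoc_mult_mat[of _ n n _ n _ n])
  \<comment> \<open>\<open>A\<close> scales the first column \<open>v\<close> of \<open>W\<close> by
    \<open>e\<close>, and \<open>W\<^sup>T\<close> sends \<open>v\<close> to the first unit vector.
    Symmetry of \<open>B\<close> then clears the first row as well.\<close>
  have col0: "col B 0 = e \<cdot>\<^sub>v unit_vec n 0"
  proof -
    have "col B 0 = W\<^sup>T *\<^sub>v (A *\<^sub>v col W 0)"
      unfolding B_def using A W \<open>n > 0\<close>
      by (simp add: assoc_mult_mat[of _ n n _ n _ n] col_mult2[of _ n n _ n]
          del: col_mult)
    also have "\<dots> = e \<cdot>\<^sub>v (W\<^sup>T *\<^sub>v col W 0)"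
      unfolding W0 Av using W v by (simp add: mult_mat_vec[of _ n n])
    also have "W\<^sup>T *\<^sub>v col W 0 = col (W\<^sup>T * W) 0"
      using W \<open>n > 0\<close> by auto
    finally show ?thesis using \<open>n > 0\<close> by (simp add: WW)
  qed
  have B_col: "B $$ (i, 0) = (if i = 0 then e else 0)" if "i < n" for i
    using arg_cong[OF col0, of "\<lambda>v. v $ i"] that B \<open>n > 0\<close> by (simp split: if_splits)
  have B_row: "B $$ (0, i) = (if i = 0 then e else 0)" if "i < n" for i
    using B_col[OF that] symB B that \<open>n > 0\<close> by (metis carrier_matD index_transpose_mat(1))
  define A3 where "A3 = mat m m (\<lambda>(i, j). B $$ (Suc i, Suc j))"
  have A3: "A3 \<in> carrier_mat m m" by (simp add: A3_def)
  let ?e = "mat 1 1 (\<lambda>_. e)"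
  have B_blk: "B = four_block_mat ?e (0\<^sub>m 1 m) (0\<^sub>m m 1) A3"
    by (rule eq_matI) (use B in \<open>auto simp: n A3_def B_col B_row\<close>)
  have sym3: "A3\<^sup>T = A3"
  proof (rule eq_matI)
    fix i j assume "i < dim_row A3" "j < dim_col A3"
    then show "A3\<^sup>T $$ (i, j) = A3 $$ (i, j)"
      using symB B n by (auto simp: A3_def) (metis Suc_mono carrier_matD index_transpose_mat(1))
  qed (auto simp: A3_def)
  have "similar_mat_wit A B W (W\<^sup>T)"
    by (rule similar_mat_witI[of _ _ n]) (use A B W WW WW' A_eq in auto)
  then have "char_poly B = char_poly A"
    by (metis char_poly_similar similar_mat_def)
  moreover have "char_poly B = char_poly ?e * char_poly A3"
    unfolding B_blk by (rule char_poly_four_block_zeros_col[OF _ _ A3]) auto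
  moreover have "char_poly ?e = [:- e, 1:]"
    by (simp add: char_poly_defs det_def sign_def)
  \<comment> \<open>Similarity and the block form give two factorizations of the same polynomial;
    cancelling the nonzero factor for \<open>e\<close> leaves the premise of the induction
    hypothesis for \<open>A3\<close>.\<close>
  ultimately have "[:- e, 1:] * char_poly A3 = [:- e, 1:] * (\<Prod>e\<leftarrow>es. [:- e, 1:])"
    using cp by simp
  then have "char_poly A3 = (\<Prod>e\<leftarrow>es. [:- e, 1:])"
    by (metis mult_cancel_left pCons_eq_0_iff zero_neq_one)
  from Cons.IH[OF A3 sym3 this] obtain R where R: "R \<in> carrier_mat m m"
    and RR: "R\<^sup>T * R = 1\<^sub>m m" and A3_eq: "A3 = R * mat_diag m ((!) es) * R\<^sup>T"
    by auto
  let ?Z = "0\<^sub>m 1 m :: real mat" and ?Z' = "0\<^sub>m m 1 :: real mat"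
  \<comment> \<open>Bordering \<open>R\<close> by a corner entry 1 diagonalizes \<open>B\<close>, so
    \<open>W * S\<close> diagonalizes \<open>A\<close>.\<close>
  define S where "S = four_block_mat (1\<^sub>m 1) ?Z ?Z' R"
  let ?D = "mat_diag n ((!) (e # es))"
  have S: "S \<in> carrier_mat n n" using R unfolding S_def n by (metis four_block_carrier_mat one_carrier_mat plus_1_eq_Suc)
  have ST: "S\<^sup>T = four_block_mat (1\<^sub>m 1) ?Z ?Z' (R\<^sup>T)"
    unfolding S_def by (subst transpose_four_block_mat[of _ 1 1 _ m _ m]) (use R in auto)
  have "S\<^sup>T * S = four_block_mat (1\<^sub>m 1) ?Z ?Z' (R\<^sup>T * R)"
    unfolding ST unfolding S_def
    by (subst mult_four_block_mat[of _ 1 1 _ m _ m _ _ 1 _ m]) (use R in auto)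
  also have "\<dots> = 1\<^sub>m n" by (simp add: RR n)
  finally have SS: "S\<^sup>T * S = 1\<^sub>m n" .
  have D: "?D = four_block_mat ?e ?Z ?Z' (mat_diag m ((!) es))"
    by (rule eq_matI) (auto simp: n mat_diag_def nth_Cons')
  have "S * ?D = four_block_mat ?e ?Z ?Z' (R * mat_diag m ((!) es))"
    unfolding D unfolding S_def
    by (subst mult_four_block_mat[of _ 1 1 _ m _ m _ _ 1 _ m])
      (use R in \<open>auto simp: left_mult_zero_mat[OF mat_diag_dim]\<close>)
  then have "S * ?D * S\<^sup>T = four_block_mat ?e ?Z ?Z' (R * mat_diag m ((!) es)) *
      four_block_mat (1\<^sub>m 1) ?Z ?Z' (R\<^sup>T)"
    by (simp only: ST)
  also have "\<dots> = B"
  proof -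
    have RD: "R * mat_diag m ((!) es) \<in> carrier_mat m m" using R by simp
    then have RDR: "R * mat_diag m ((!) es) * R\<^sup>T \<in> carrier_mat m m"
      by (rule mult_carrier_mat) (use R in simp)
    show ?thesis
      unfolding B_blk A3_eq
      by (subst mult_four_block_mat[of _ 1 1 _ m _ m _ _ 1 _ m])
        (use R RD RDR in \<open>auto simp: right_mult_zero_mat[OF RD] left_add_zero_mat[OF RDR]\<close>)
  qed
  finally have SDS: "S * ?D * S\<^sup>T = B" .
  show ?case
  proof (intro bexI[of _ "W * S"] conjI)
    have "(W * S)\<^sup>T * (W * S) = S\<^sup>T * (W\<^sup>T * W) * S"
      using W S by (simp add: transpose_mult[of _ n n _ n] assoc_mult_mat[of _ n n _ n _ n])
    also have "\<dots> = 1\<^sub>m n" using S by (simp add: WW SS)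
    finally show "(W * S)\<^sup>T * (W * S) = 1\<^sub>m n" .
    have "W * S * D * (W * S)\<^sup>T = W * (S * D * S\<^sup>T) * W\<^sup>T" if "D \<in> carrier_mat n n" for D
      using W S that by (simp add: transpose_mult[of _ n n _ n] assoc_mult_mat[of _ n n _ n _ n])
    then have "W * S * ?D * (W * S)\<^sup>T = W * (S * ?D * S\<^sup>T) * W\<^sup>T" by simp
    also have "\<dots> = A" by (simp add: SDS A_eq[symmetric])
    finally show "A = W * S * ?D * (W * S)\<^sup>T" ..
  qed (use W S in auto)
qed

section \<open>Weyl's monotonicity principle\<close>

text \<open>In the coordinates \<open>P\<^sup>T *\<^sub>v x\<close> the quadratic form of
  \<open>A\<close> has no mixed terms.\<close>

lemma scalar_prod_diagonalized:
  fixes A :: "real mat"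
  assumes P: "P \<in> carrier_mat n n" and A: "A = P * mat_diag n d * P\<^sup>T"
    and x: "x \<in> carrier_vec n"
  shows "x \<bullet> (A *\<^sub>v x) = (\<Sum>j<n. d j * ((P\<^sup>T *\<^sub>v x) $ j)\<^sup>2)"
proof -
  let ?w = "P\<^sup>T *\<^sub>v x"
  have w: "?w \<in> carrier_vec n" using P x by simp
  have D: "mat_diag n d \<in> carrier_mat n n" by simp
  have "A *\<^sub>v x = P *\<^sub>v (mat_diag n d *\<^sub>v ?w)"
    unfolding A using P x D by (simp add: assoc_mult_mat_vec[of _ n n _ n])
  then have "x \<bullet> (A *\<^sub>v x) = ?w \<bullet> (mat_diag n d *\<^sub>v ?w)"
    using transpose_vec_mult_scalar[OF P _ x, of "mat_diag n d *\<^sub>v ?w"] w D by simp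
  also have "\<dots> = (\<Sum>j<n. ?w $ j * (d j * ?w $ j))"
  proof -
    have "(mat_diag n d *\<^sub>v ?w) $ j = d j * ?w $ j" if "j < n" for j
    proof -
      have "(mat_diag n d *\<^sub>v ?w) $ j = row (mat_diag n d) j \<bullet> ?w"
        using that by (simp add: mat_diag_def)
      also have "\<dots> = (\<Sum>k<n. if k = j then d j * ?w $ j else 0)"
        unfolding scalar_prod_def using that carrier_vecD[OF w]
        by (intro sum.cong) (auto simp: mat_diag_def)
      finally show ?thesis using that by simp
    qed
    then show ?thesis
      unfolding scalar_prod_def[of ?w] using carrier_vecD[OF mult_mat_vec_carrier[OF D w]]
      by (simp add: atLeast0LessThan del: index_mult_mat_vec)
  qed
  also have "\<dots> = (\<Sum>j<n. d j * (?w $ j)\<^sup>2)"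
    by (simp add: power2_eq_square mult_ac)
  finally show ?thesis .
qed

lemma orthogonal_mat_scalar_prod:
  fixes P :: "real mat"
  assumes P: "P \<in> carrier_mat n n" and PP: "P\<^sup>T * P = 1\<^sub>m n" and x: "x \<in> carrier_vec n"
  shows "x \<bullet> x = (\<Sum>j<n. ((P\<^sup>T *\<^sub>v x) $ j)\<^sup>2)"
proof -
  have "P * P\<^sup>T = 1\<^sub>m n"
    by (rule mat_mult_left_right_inverse[OF _ P PP]) (use P in auto)
  \<comment> \<open>The identity is diagonalized by \<open>P\<close> with all eigenvalues 1, so
    Parseval's identity is an instance of the formula for quadratic forms.\<close>
  then have "1\<^sub>m n = P * mat_diag n (\<lambda>_. 1) * P\<^sup>T" using P by simp
  from scalar_prod_diagonalized[OF P this x] show ?thesis using x by simp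
qed

theorem weyl_monotonicity:
  fixes A B :: "real mat"
  assumes P: "P \<in> carrier_mat n n" "P\<^sup>T * P = 1\<^sub>m n" and A: "A = P * mat_diag n d * P\<^sup>T"
    and R: "R \<in> carrier_mat n n" "R\<^sup>T * R = 1\<^sub>m n" and B: "B = R * mat_diag n f * R\<^sup>T"
    and d: "\<And>i j. i \<le> j \<Longrightarrow> j < n \<Longrightarrow> d j \<le> d i"
    and f: "\<And>i j. i \<le> j \<Longrightarrow> j < n \<Longrightarrow> f j \<le> f i"
    and le: "\<And>x. x \<in> carrier_vec n \<Longrightarrow> x \<bullet> (A *\<^sub>v x) \<le> x \<bullet> (B *\<^sub>v x)"
    and k: "k < n"
  shows "d k \<le> f k"
proof -
  \<comment> \<open>The span of the first \<open>k + 1\<close> columns of \<open>P\<close> contains a nonzero vector \<open>x\<close> orthogonal to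
    the first \<open>k\<close> columns of \<open>R\<close>; \<open>y\<close> holds its coordinates. The last row of \<open>M\<close> only pads
    it to a singular square matrix.\<close>
  define T where "T = R\<^sup>T * P"
  have T: "T \<in> carrier_mat n n" using P R by (simp add: T_def)
  define M where "M = mat (Suc k) (Suc k) (\<lambda>(i, j). if i < k then T $$ (i, j) else 0)"
  have M: "M \<in> carrier_mat (Suc k) (Suc k)" by (simp add: M_def)
  have "det M = 0"
    unfolding det_def'[OF M]
  proof (intro sum.neutral ballI)
    fix p assume "p \<in> {p. p permutes {0..<Suc k}}"
    then have p: "p permutes {0..<Suc k}" by simp
    \<comment> \<open>Row \<open>k\<close> of \<open>M\<close> is zero, so each product in the
      Leibniz expansion has a zero factor.\<close>
    have "M $$ (k, p k) = 0"
      using permutes_in_image[OF p, of k] by (simp add: M_def)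
    then have "(\<Prod>i = 0..<Suc k. M $$ (i, p i)) = 0" by (intro prod_zero) auto
    then show "signof p * (\<Prod>i = 0..<Suc k. M $$ (i, p i)) = 0" by simp
  qed
  then obtain y where y: "y \<in> carrier_vec (Suc k)" "y \<noteq> 0\<^sub>v (Suc k)"
    and My: "M *\<^sub>v y = 0\<^sub>v (Suc k)"
    using det_0_iff_vec_prod_zero[OF M] by auto
  define z where "z = vec n (\<lambda>j. if j \<le> k then y $ j else 0)"
  have z: "z \<in> carrier_vec n" by (simp add: z_def)
  define x where "x = P *\<^sub>v z"
  have x: "x \<in> carrier_vec n" using P z by (simp add: x_def)
  have Px: "P\<^sup>T *\<^sub>v x = z"
    using P z assoc_mult_mat_vec[of "P\<^sup>T" n n P n z] by (simp add: x_def)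
  have Rx: "R\<^sup>T *\<^sub>v x = T *\<^sub>v z"
    using P R z assoc_mult_mat_vec[of "R\<^sup>T" n n P n z] by (simp add: x_def T_def)
  have Rx0: "(R\<^sup>T *\<^sub>v x) $ i = 0" if i: "i < k" for i
  proof -
    have "(R\<^sup>T *\<^sub>v x) $ i = (\<Sum>j<n. T $$ (i, j) * z $ j)"
      unfolding Rx using T z i k by (simp add: scalar_prod_def atLeast0LessThan)
    also have "\<dots> = (\<Sum>j<Suc k. T $$ (i, j) * y $ j)"
      by (rule sum.mono_neutral_cong_right) (use k in \<open>auto simp: z_def\<close>)
    also have "\<dots> = (M *\<^sub>v y) $ i"
      using i y(1) by (auto simp: M_def scalar_prod_def atLeast0LessThan simp del: sum.lessThan_Suc)
    finally show ?thesis using i by (simp add: My)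
  qed
  obtain j where "j < Suc k" "y $ j \<noteq> 0"
    using y by (metis carrier_vecD eq_vecI index_zero_vec(1) index_zero_vec(2))
  then have j: "j < n" "z $ j \<noteq> 0" using k by (auto simp: z_def)
  have xx: "x \<bullet> x = (\<Sum>j<n. (z $ j)\<^sup>2)"
    using orthogonal_mat_scalar_prod[OF P x] by (simp add: Px)
  have pos: "x \<bullet> x > 0"
    unfolding xx using j by (intro sum_pos2[of _ j]) auto
  \<comment> \<open>The quadratic forms are compared at \<open>x\<close>. Its
    \<open>P\<close>-coordinates \<open>z\<close> vanish beyond index \<open>k\<close>, leaving only
    weights \<open>d j \<ge> d k\<close>; its \<open>R\<close>-coordinates vanish before index
    \<open>k\<close>, leaving only weights \<open>f j \<le> f k\<close>.\<close>
  have "d k * (x \<bullet> x) = (\<Sum>j<n. d k * (z $ j)\<^sup>2)"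
    by (simp add: xx sum_distrib_left)
  also have "\<dots> \<le> (\<Sum>j<n. d j * (z $ j)\<^sup>2)"
  proof (rule sum_mono)
    fix i assume "i \<in> {..<n}"
    then show "d k * (z $ i)\<^sup>2 \<le> d i * (z $ i)\<^sup>2"
      by (cases "i \<le> k") (auto simp: z_def d k intro: mult_right_mono)
  qed
  also have "\<dots> = x \<bullet> (A *\<^sub>v x)"
    using scalar_prod_diagonalized[OF P(1) A x] by (simp add: Px)
  also have "\<dots> \<le> x \<bullet> (B *\<^sub>v x)" by (rule le[OF x])
  also have "\<dots> = (\<Sum>j<n. f j * ((R\<^sup>T *\<^sub>v x) $ j)\<^sup>2)"
    by (rule scalar_prod_diagonalized[OF R(1) B x])
  also have "\<dots> \<le> (\<Sum>j<n. f k * ((R\<^sup>T *\<^sub>v x) $ j)\<^sup>2)"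
  proof (rule sum_mono)
    fix i assume "i \<in> {..<n}"
    then show "f i * ((R\<^sup>T *\<^sub>v x) $ i)\<^sup>2 \<le> f k * ((R\<^sup>T *\<^sub>v x) $ i)\<^sup>2"
      using Rx0[of i] f[of k i] by (cases "i < k") (auto intro: mult_right_mono)
  qed
  also have "\<dots> = f k * (x \<bullet> x)"
    using orthogonal_mat_scalar_prod[OF R x] by (simp add: sum_distrib_left)
  finally show ?thesis using pos by simp
qed

text \<open>Each diagonal entry of \<open>A\<close> is a combination of the \<open>d j\<close> with
  weights the squared entries of a row of \<open>P\<close>. After exchanging the sums, the total
  weight of \<open>d j\<close> is the squared norm of column \<open>j\<close>, which is 1.\<close>

lemma sum_eigenvalues_eq_trace:
  fixes A :: "real mat"
  assumes P: "P \<in> carrier_mat n n" "P\<^sup>T * P = 1\<^sub>m n" and A: "A = P * mat_diag n d * P\<^sup>T"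
  shows "(\<Sum>i<n. A $$ (i, i)) = (\<Sum>j<n. d j)"
proof -
  have "A $$ (i, i) = (\<Sum>j<n. d j * (P $$ (i, j))\<^sup>2)" if "i < n" for i
  proof -
    have "(M * P\<^sup>T) $$ (i, i) = (\<Sum>j<n. M $$ (i, j) * P $$ (i, j))"
      if "M \<in> carrier_mat n n" for M
      using P \<open>i < n\<close> that by (simp add: scalar_prod_def atLeast0LessThan)
    then have "A $$ (i, i) = (\<Sum>j<n. (P * mat_diag n d) $$ (i, j) * P $$ (i, j))"
      using P by (simp add: A del: index_mult_mat(1))
    also have "\<dots> = (\<Sum>j<n. d j * (P $$ (i, j))\<^sup>2)"
      using P that by (simp add: mat_diag_mult_right[of _ n n] power2_eq_square mult_ac)
    finally show ?thesis .
  qed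
  then have "(\<Sum>i<n. A $$ (i, i)) = (\<Sum>i<n. \<Sum>j<n. d j * (P $$ (i, j))\<^sup>2)" by simp
  also have "\<dots> = (\<Sum>j<n. d j * (\<Sum>i<n. (P $$ (i, j))\<^sup>2))"
    by (subst sum.swap) (simp add: sum_distrib_left)
  also have "\<dots> = (\<Sum>j<n. d j)"
  proof (intro sum.cong refl)
    fix j assume "j \<in> {..<n}"
    then have "(\<Sum>i<n. (P $$ (i, j))\<^sup>2) = (P\<^sup>T * P) $$ (j, j)"
      using P(1) by (simp add: scalar_prod_def atLeast0LessThan power2_eq_square)
    then show "d j * (\<Sum>i<n. (P $$ (i, j))\<^sup>2) = d j"
      using \<open>j \<in> {..<n}\<close> by (simp add: P(2))
  qed
  finally show ?thesis .
qed

section \<open>The Laplacian spectrum\<close>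

lemma finite_possible_edges: "finite (possible_edges n)"
  by (rule finite_subset[of _ "{..<n} \<times> {..<n}"]) (auto simp: possible_edges_def)

section \<open>Incidence matrix, quadratic form and trace\<close>

lemma incidence_matrix_carrier: "incidence_matrix n E \<in> carrier_mat n (length (edge_list n E))"
  by (simp add: incidence_matrix_def Let_def)

lemma transpose_incidence_matrix_mult_vec:
  assumes E: "E \<subseteq> possible_edges n" and x: "x \<in> carrier_vec n"
    and k: "k < length (edge_list n E)"
  shows "((incidence_matrix n E)\<^sup>T *\<^sub>v x) $ k
    = x $ fst (edge_list n E ! k) - x $ snd (edge_list n E ! k)"
proof -
  obtain a b where ab: "edge_list n E ! k = (a, b)" by (cases "edge_list n E ! k")
  then have "(a, b) \<in> possible_edges n" using nth_mem[OF k] by (simp add: set_edge_list)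
  then have ab': "b < a" "a < n" by (auto simp: possible_edges_def)
  \<comment> \<open>Since \<open>a\<close> and \<open>b\<close> differ, the nested conditional
    defining an incidence entry is a difference of two indicators.\<close>
  have "((incidence_matrix n E)\<^sup>T *\<^sub>v x) $ k
      = (\<Sum>v<n. (if v = a then x $ a else 0) - (if v = b then x $ b else 0))"
    using k x ab ab' by (auto simp: incidence_matrix_def Let_def scalar_prod_def atLeast0LessThan
        intro!: sum.cong)
  then show ?thesis using ab ab' by (simp add: sum_subtractf)
qed

lemma laplacian_carrier: "laplacian n E \<in> carrier_mat n n"
  using incidence_matrix_carrier[of n E] by (simp add: laplacian_def)

lemma laplacian_symmetric: "(laplacian n E)\<^sup>T = laplacian n E"
  using incidence_matrix_carrier[of n E]
  by (simp add: laplacian_def transpose_mult[of _ n "length (edge_list n E)" _ n])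

lemma laplacian_mult_vec:
  assumes "x \<in> carrier_vec n"
  shows "laplacian n E *\<^sub>v x = incidence_matrix n E *\<^sub>v ((incidence_matrix n E)\<^sup>T *\<^sub>v x)"
  unfolding laplacian_def
  by (rule assoc_mult_mat_vec) (use incidence_matrix_carrier[of n E] assms in auto)

text \<open>With \<open>Q\<close> the incidence matrix, the form is the squared norm of
  \<open>Q\<^sup>T *\<^sub>v x\<close>, whose entries are the differences of \<open>x\<close> along
  the edges. As the edge list is distinct, summing over its positions is summing over
  \<open>E\<close>.\<close>

lemma laplacian_quadratic_form:
  assumes E: "E \<subseteq> possible_edges n" and x: "x \<in> carrier_vec n"
  shows "x \<bullet> (laplacian n E *\<^sub>v x) = (\<Sum>(i, j)\<in>E. (x $ i - x $ j)\<^sup>2)"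
proof -
  let ?es = "edge_list n E"
  let ?m = "length ?es"
  let ?w = "(incidence_matrix n E)\<^sup>T *\<^sub>v x"
  define g where "g = (\<lambda>(i, j). x $ i - x $ j)"
  note Q = incidence_matrix_carrier[of n E]
  have w: "?w \<in> carrier_vec ?m" using Q x by simp
  have "x \<bullet> (laplacian n E *\<^sub>v x) = ?w \<bullet> ?w"
    using transpose_vec_mult_scalar[OF Q w x] by (simp add: laplacian_mult_vec[OF x])
  also have "\<dots> = (\<Sum>k<?m. (g (?es ! k))\<^sup>2)"
    unfolding scalar_prod_def[of ?w] carrier_vecD[OF w]
    by (auto simp: transpose_incidence_matrix_mult_vec[OF E x] g_def split_def power2_eq_square
        atLeast0LessThan simp del: index_mult_mat_vec intro!: sum.cong)
  also have "\<dots> = (\<Sum>e\<in>E. (g e)\<^sup>2)"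
    by (rule sum.reindex_bij_betw[OF bij_betw_nth])
      (use E in \<open>auto simp: distinct_edge_list set_edge_list\<close>)
  also have "\<dots> = (\<Sum>(i, j)\<in>E. (x $ i - x $ j)\<^sup>2)"
    by (simp add: g_def split_def)
  finally show ?thesis .
qed

text \<open>Additional edges only add squares.\<close>

lemma laplacian_quadratic_form_mono:
  assumes "E \<subseteq> E'" "E' \<subseteq> possible_edges n" "x \<in> carrier_vec n"
  shows "x \<bullet> (laplacian n E *\<^sub>v x) \<le> x \<bullet> (laplacian n E' *\<^sub>v x)"
proof -
  have "finite E'" using assms finite_possible_edges finite_subset by blast
  then have "(\<Sum>(i, j)\<in>E. (x $ i - x $ j)\<^sup>2) \<le> (\<Sum>(i, j)\<in>E'. (x $ i - x $ j)\<^sup>2)"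
    using assms(1) by (intro sum_mono2) auto
  then show ?thesis using assms by (simp add: laplacian_quadratic_form)
qed

text \<open>A diagonal entry is the quadratic form at a unit vector, that is, the degree of the
  vertex. Exchanging the sums counts every edge once at each of its two ends.\<close>

lemma laplacian_trace:
  assumes E: "E \<subseteq> possible_edges n"
  shows "(\<Sum>i<n. laplacian n E $$ (i, i)) = 2 * real (card E)"
proof -
  have diag: "laplacian n E $$ (v, v)
      = (\<Sum>(i, j)\<in>E. ((if i = v then 1 else 0) - (if j = v then 1 else 0))\<^sup>2)" if v: "v < n" for v
  proof -
    have "laplacian n E $$ (v, v) = unit_vec n v \<bullet> (laplacian n E *\<^sub>v unit_vec n v)"
      using v laplacian_carrier[of n E] by simp
    also have "\<dots> = (\<Sum>(i, j)\<in>E. (unit_vec n v $ i - unit_vec n v $ j)\<^sup>2)"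
      by (rule laplacian_quadratic_form[OF E]) simp
    also have "\<dots> = (\<Sum>(i, j)\<in>E. ((if i = v then 1 else 0) - (if j = v then 1 else 0))\<^sup>2)"
      using E v by (intro sum.cong refl) (auto simp: possible_edges_def unit_vec_def)
    finally show ?thesis .
  qed
  have "(\<Sum>i<n. laplacian n E $$ (i, i))
      = (\<Sum>e\<in>E. \<Sum>v<n. ((if fst e = v then 1 else 0) - (if snd e = v then 1 else 0))\<^sup>2)"
    by (simp add: diag split_def sum.swap[of _ _ E])
  also have "\<dots> = (\<Sum>e\<in>E. 2)"
  proof (rule sum.cong[OF refl])
    fix e assume "e \<in> E"
    then obtain a b where e: "e = (a, b)" "b < a" "a < n"
      using E by (cases e) (auto simp: possible_edges_def)
    have "(\<Sum>v<n. ((if fst e = v then 1 else 0) - (if snd e = v then 1 else 0))\<^sup>2)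
        = (\<Sum>v<n. (if v = a then 1 else 0) + (if v = b then 1 else 0) :: real)"
      using e by (intro sum.cong) auto
    then show "(\<Sum>v<n. ((if fst e = v then 1 else 0) - (if snd e = v then 1 else 0))\<^sup>2) = (2::real)"
      using e by (simp add: sum.distrib)
  qed
  finally show ?thesis by simp
qed

section \<open>The ordered list of Laplacian eigenvalues\<close>

lemma char_poly_laplacian:
  "char_poly (laplacian n E) = (\<Prod>e\<leftarrow>laplacian_eigenvalues n E. [:- e, 1:])"
proof -
  obtain as where as: "char_poly (laplacian n E) = (\<Prod>a\<leftarrow>as. [:- a, 1:])"
    using char_poly_symmetric_splits[OF laplacian_carrier laplacian_symmetric] .
  \<comment> \<open>For a product of monic linear factors, \<open>proots\<close> returns exactly the
    listed roots with multiplicity. Sorting them does not change the product.\<close>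
  have "proots (\<Prod>a\<leftarrow>as. [:- a, 1:]) = mset as"
  proof (induction as)
    case (Cons a as)
    have "(\<Prod>a\<leftarrow>as. [:- a, 1:]) \<noteq> 0" by (auto simp: prod_list_zero_iff)
    then show ?case using Cons by (simp add: proots_mult del: mult_pCons_left)
  qed simp
  then have "mset (laplacian_eigenvalues n E) = mset as"
    by (simp add: laplacian_eigenvalues_def laplacian_spectrum_def as)
  then show ?thesis
    unfolding as by (metis mset_map prod_mset_prod_list)
qed

text \<open>Comparing degrees gives the length; hence every index \<open>k < n\<close> used below
  lies inside the list.\<close>

lemma length_laplacian_eigenvalues: "length (laplacian_eigenvalues n E) = n"
proof -
  have "degree (\<Prod>e\<leftarrow>es. [:- e, 1:]) = length es" for es :: "real list"
  proof (induction es)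
    case (Cons e es)
    have "(\<Prod>a\<leftarrow>es. [:- a, 1:]) \<noteq> 0" by (auto simp: prod_list_zero_iff)
    then show ?case using Cons by (simp add: degree_mult_eq del: mult_pCons_left)
  qed simp
  then show ?thesis
    using degree_monic_char_poly[OF laplacian_carrier[of n E]] by (simp add: char_poly_laplacian)
qed

lemma laplacian_eigenvalues_decreasing:
  assumes "i \<le> j" "j < n"
  shows "laplacian_eigenvalues n E ! j \<le> laplacian_eigenvalues n E ! i"
proof -
  have "sorted (rev (laplacian_eigenvalues n E))"
    by (simp add: laplacian_eigenvalues_def)
  then show ?thesis
    using assms by (simp add: sorted_rev_iff_nth_mono length_laplacian_eigenvalues)
qed

lemma laplacian_diagonalization:
  obtains P where "P \<in> carrier_mat n n" "P\<^sup>T * P = 1\<^sub>m n"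
    "laplacian n E = P * mat_diag n ((!) (laplacian_eigenvalues n E)) * P\<^sup>T"
  using real_spectral_theorem[OF laplacian_carrier laplacian_symmetric char_poly_laplacian] by blast

section \<open>Eigenvalues under changes of the edge set\<close>

lemma laplacian_eigenvalues_mono:
  assumes "E \<subseteq> E'" "E' \<subseteq> possible_edges n" "k < n"
  shows "laplacian_eigenvalues n E ! k \<le> laplacian_eigenvalues n E' ! k"
proof -
  obtain P where P: "P \<in> carrier_mat n n" "P\<^sup>T * P = 1\<^sub>m n"
    "laplacian n E = P * mat_diag n ((!) (laplacian_eigenvalues n E)) * P\<^sup>T"
    by (rule laplacian_diagonalization)
  obtain R where R: "R \<in> carrier_mat n n" "R\<^sup>T * R = 1\<^sub>m n"
    "laplacian n E' = R * mat_diag n ((!) (laplacian_eigenvalues n E')) * R\<^sup>T"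
    by (rule laplacian_diagonalization)
  show ?thesis
    by (rule weyl_monotonicity[OF P R laplacian_eigenvalues_decreasing
          laplacian_eigenvalues_decreasing laplacian_quadratic_form_mono[OF assms(1,2)] assms(3)])
qed

lemma sum_laplacian_eigenvalues:
  assumes "E \<subseteq> possible_edges n"
  shows "(\<Sum>k<n. laplacian_eigenvalues n E ! k) = 2 * real (card E)"
proof -
  obtain P where "P \<in> carrier_mat n n" "P\<^sup>T * P = 1\<^sub>m n"
    "laplacian n E = P * mat_diag n ((!) (laplacian_eigenvalues n E)) * P\<^sup>T"
    by (rule laplacian_diagonalization)
  from sum_eigenvalues_eq_trace[OF this] laplacian_trace[OF assms] show ?thesis by simp
qed

lemma laplacian_eigenvalues_dist_le:
  assumes E1: "E1 \<subseteq> possible_edges n" and E2: "E2 \<subseteq> possible_edges n"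
  shows "(\<Sum>k<n. \<bar>laplacian_eigenvalues n E1 ! k - laplacian_eigenvalues n E2 ! k\<bar>)
    \<le> 2 * real (card (E1 - E2)) + 2 * real (card (E2 - E1))"
proof -
  let ?F = "E1 \<inter> E2"
  let ?l = "\<lambda>E k. laplacian_eigenvalues n E ! k"
  have fin: "finite E1" "finite E2"
    using E1 E2 finite_possible_edges finite_subset by blast+
  have F: "?F \<subseteq> possible_edges n" using E1 by auto
  have card: "card E1 = card ?F + card (E1 - E2)" "card E2 = card ?F + card (E2 - E1)"
    using fin by (metis Diff_Diff_Int card_Diff_subset_Int card_Int_Diff finite_Int inf_commute)+
  \<comment> \<open>Both spectra dominate that of \<open>?F\<close> entry by entry, so each distance
    is at most the sum of two nonnegative gaps. These gaps sum to differences of traces.\<close>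
  have "(\<Sum>k<n. \<bar>?l E1 k - ?l E2 k\<bar>) \<le> (\<Sum>k<n. (?l E1 k - ?l ?F k) + (?l E2 k - ?l ?F k))"
  proof (rule sum_mono)
    fix k assume "k \<in> {..<n}"
    then have "?l ?F k \<le> ?l E1 k" "?l ?F k \<le> ?l E2 k"
      using E1 E2 by (auto intro!: laplacian_eigenvalues_mono)
    then show "\<bar>?l E1 k - ?l E2 k\<bar> \<le> (?l E1 k - ?l ?F k) + (?l E2 k - ?l ?F k)" by linarith
  qed
  also have "\<dots> = 2 * real (card (E1 - E2)) + 2 * real (card (E2 - E1))"
    using sum_laplacian_eigenvalues[OF E1] sum_laplacian_eigenvalues[OF E2]
      sum_laplacian_eigenvalues[OF F]
    by (simp add: sum.distrib sum_subtractf card flip: sum_distrib_left)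
  finally show ?thesis .
qed

section \<open>Graphs on three vertices\<close>

lemma possible_edges_3: "possible_edges 3 = {(1, 0), (2, 0), (2, 1)}"
  by (auto simp: possible_edges_def)

text \<open>The quadratic form at an eigenvector \<open>v\<close> is
  \<open>?a * (v \<bullet> v)\<close>. It is nonnegative, and at most the form of the triangle,
  which never exceeds \<open>3 * (v \<bullet> v)\<close>.\<close>

lemma laplacian_eigenvalue_bounds_3:
  assumes E: "E \<subseteq> possible_edges 3" and k: "k < 3"
  shows "0 \<le> laplacian_eigenvalues 3 E ! k" "laplacian_eigenvalues 3 E ! k \<le> 3"
proof -
  let ?L = "laplacian 3 E"
  let ?a = "laplacian_eigenvalues 3 E ! k"
  have "?a \<in> set (laplacian_eigenvalues 3 E)"
    using k by (simp add: length_laplacian_eigenvalues)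
  then have "poly (char_poly ?L) ?a = 0"
    unfolding char_poly_laplacian by (rule linear_poly_root)
  then have "eigenvalue ?L ?a"
    by (simp add: eigenvalue_root_char_poly[OF laplacian_carrier])
  then obtain v where v: "v \<in> carrier_vec 3" "v \<noteq> 0\<^sub>v 3" "?L *\<^sub>v v = ?a \<cdot>\<^sub>v v"
    using laplacian_carrier[of 3 E] unfolding eigenvalue_def eigenvector_def by auto
  have pos: "v \<bullet> v > 0"
    using v conjugate_square_greater_0_vec[of v 3] by simp
  have eq: "v \<bullet> (?L *\<^sub>v v) = ?a * (v \<bullet> v)" using v by simp
  have "0 \<le> v \<bullet> (?L *\<^sub>v v)"
    unfolding laplacian_quadratic_form[OF E v(1)] by (auto intro: sum_nonneg)
  then show "0 \<le> ?a" using pos by (simp add: eq zero_le_mult_iff)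
  have "v \<bullet> (?L *\<^sub>v v) \<le> v \<bullet> (laplacian 3 (possible_edges 3) *\<^sub>v v)"
    by (rule laplacian_quadratic_form_mono[OF E order_refl v(1)])
  also have "\<dots> = (v $ 1 - v $ 0)\<^sup>2 + (v $ 2 - v $ 0)\<^sup>2 + (v $ 2 - v $ 1)\<^sup>2"
    using v by (simp add: laplacian_quadratic_form possible_edges_3)
  \<comment> \<open>The triangle has Laplacian 3 times the identity minus the all-ones
    matrix.\<close>
  also have "\<dots> = 3 * (v \<bullet> v) - (v $ 0 + v $ 1 + v $ 2)\<^sup>2"
  proof -
    have "v \<bullet> v = v $ 0 * v $ 0 + v $ 1 * v $ 1 + v $ 2 * v $ 2"
      unfolding scalar_prod_def carrier_vecD[OF v(1)] by (simp add: numeral_eq_Suc)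
    then show ?thesis by (simp add: power2_eq_square algebra_simps)
  qed
  also have "\<dots> \<le> 3 * (v \<bullet> v)" by simp
  finally show "?a \<le> 3" using pos by (simp add: eq)
qed

text \<open>The constant vector has zero difference along every edge, so it lies in the
  kernel.\<close>

lemma laplacian_eigenvalue_zero:
  assumes E: "E \<subseteq> possible_edges n" and n: "n > 0"
  shows "0 \<in> set (laplacian_eigenvalues n E)"
proof -
  let ?one = "vec n (\<lambda>_. 1) :: real vec"
  have "(incidence_matrix n E)\<^sup>T *\<^sub>v ?one = 0\<^sub>v (length (edge_list n E))"
  proof (rule eq_vecI)
    fix k assume "k < dim_vec (0\<^sub>v (length (edge_list n E)) :: real vec)"
    then have k: "k < length (edge_list n E)" by simp
    then have "edge_list n E ! k \<in> possible_edges n"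
      using nth_mem[OF k] by (simp add: set_edge_list)
    then show "((incidence_matrix n E)\<^sup>T *\<^sub>v ?one) $ k = 0\<^sub>v (length (edge_list n E)) $ k"
      using k by (auto simp: transpose_incidence_matrix_mult_vec[OF E] possible_edges_def
          simp del: index_mult_mat_vec)
  qed (use incidence_matrix_carrier[of n E] in simp)
  then have "laplacian n E *\<^sub>v ?one = 0\<^sub>v n"
    using incidence_matrix_carrier[of n E] by (auto simp: laplacian_mult_vec)
  moreover have "?one \<noteq> 0\<^sub>v n"
    using n by (metis index_vec index_zero_vec(1) zero_neq_one)
  ultimately have "eigenvalue (laplacian n E) 0"
    using laplacian_carrier[of n E] unfolding eigenvalue_def eigenvector_def
    by (intro exI[of _ ?one]) auto
  then have "poly (\<Prod>e\<leftarrow>laplacian_eigenvalues n E. [:- e, 1:]) 0 = 0"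
    by (simp add: eigenvalue_root_char_poly[OF laplacian_carrier] char_poly_laplacian)
  then show ?thesis
    by (auto simp: poly_prod_list prod_list_zero_iff)
qed

text \<open>The value 0 occurs and no eigenvalue is negative, so it is the last entry of the
  decreasing list.\<close>

lemma laplacian_eigenvalue_last_3:
  assumes E: "E \<subseteq> possible_edges 3"
  shows "laplacian_eigenvalues 3 E ! 2 = 0"
proof -
  obtain k where "k < 3" "laplacian_eigenvalues 3 E ! k = 0"
    using laplacian_eigenvalue_zero[OF E] by (auto simp: in_set_conv_nth length_laplacian_eigenvalues)
  then have "laplacian_eigenvalues 3 E ! 2 \<le> 0"
    using laplacian_eigenvalues_decreasing[of k 2 3 E] by simp
  then show ?thesis using laplacian_eigenvalue_bounds_3[OF E, of 2] by simp
qed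

text \<open>The two largest eigenvalues sum to \<open>2 * m\<close>. For \<open>m = 1\<close>, order
  and nonnegativity put the first in [1, 2]; for \<open>m = 2\<close>, order and the bound 3 put it
  in [2, 3]. The first two distances are thus equal and at most 1.\<close>

lemma laplacian_eigenvalues_dist_3:
  assumes E1: "E1 \<subseteq> possible_edges 3" and E2: "E2 \<subseteq> possible_edges 3"
    and card: "card E1 = m" "card E2 = m" and m: "m = 1 \<or> m = 2"
  shows "(\<Sum>k<3. \<bar>laplacian_eigenvalues 3 E1 ! k - laplacian_eigenvalues 3 E2 ! k\<bar>) \<le> 3"
proof -
  have sum3: "(\<Sum>k<3. f k) = f 0 + f 1 + f 2" for f :: "nat \<Rightarrow> real"
    by (simp add: eval_nat_numeral)
  have "laplacian_eigenvalues 3 E ! 0 + laplacian_eigenvalues 3 E ! 1 = 2 * m"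
    "laplacian_eigenvalues 3 E ! 1 \<le> laplacian_eigenvalues 3 E ! 0"
    "0 \<le> laplacian_eigenvalues 3 E ! 1" "laplacian_eigenvalues 3 E ! 0 \<le> 3"
    if "E \<subseteq> possible_edges 3" "card E = m" for E
    using that sum_laplacian_eigenvalues[of E 3] laplacian_eigenvalue_last_3[of E]
      laplacian_eigenvalues_decreasing[of 0 1 3 E] laplacian_eigenvalue_bounds_3[of E 0]
      laplacian_eigenvalue_bounds_3[of E 1]
    by (simp_all add: sum3)
  from this[OF E1 card(1)] this[OF E2 card(2)] show ?thesis
    using m unfolding sum3 laplacian_eigenvalue_last_3[OF E1] laplacian_eigenvalue_last_3[OF E2]
    by (auto simp: abs_if)
qed

section \<open>The general bound and the remaining small cases\<close>

theorem theorem5p2: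
  fixes n l :: nat and E1 E2 :: "(nat \<times> nat) set"
  assumes "E1 \<subseteq> possible_edges n"
    and "E2 \<subseteq> possible_edges n"
    and "card E1 = card E2"
    and "l = card (E1 - E2)"
    and "l = card (E2 - E1)"
  shows "(\<Sum>k<n. \<bar>laplacian_eigenvalues n E1 ! k - laplacian_eigenvalues n E2 ! k\<bar>)
    \<le> real n * real l"
proof -
  let ?s = "\<Sum>k<n. \<bar>laplacian_eigenvalues n E1 ! k - laplacian_eigenvalues n E2 ! k\<bar>"
  have le4: "?s \<le> 4 * real l"
    using laplacian_eigenvalues_dist_le[OF assms(1,2)] assms(4,5) by simp
  have fin: "finite E1" "finite E2"
    using assms(1,2) finite_possible_edges finite_subset by blast+
  show ?thesis
  proof (cases "n \<ge> 4 \<or> l = 0")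
    case True
    then show ?thesis
    proof
      assume "n \<ge> 4"
      then have "4 * real l \<le> real n * real l" by (intro mult_right_mono) auto
      with le4 show ?thesis by linarith
    qed (use le4 in simp)
  next
    case False
    then have n: "n \<le> 3" and l: "l \<ge> 1" by auto
    have E1: "card E1 = card (E1 \<inter> E2) + l"
      using fin assms(4) by (simp add: card_Int_Diff[of E1 E2])
    \<comment> \<open>The union splits into common edges and two disjoint sets of \<open>l\<close>
      differing edges, all of which must fit among the possible edges.\<close>
    have "card E1 + l = card (E1 \<union> E2)"
      using fin assms(5) by (simp add: card_Un_disjoint[of E1 "E2 - E1", simplified])
    also have "\<dots> \<le> card (possible_edges n)"
      by (rule card_mono[OF finite_possible_edges]) (use assms(1,2) in auto)
    finally have le: "2 * l + card (E1 \<inter> E2) \<le> card (possible_edges n)" using E1 by simp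
    have n3: "n = 3"
    proof (rule ccontr)
      assume "n \<noteq> 3"
      \<comment> \<open>At most two vertices leave room for one edge, while \<open>l \<ge> 1\<close>
        requires at least two.\<close>
      then have "possible_edges n \<subseteq> {(1, 0)}"
        using n by (auto simp: possible_edges_def)
      then have "card (possible_edges n) \<le> 1"
        using card_mono[of "{(1, 0)}" "possible_edges n"] by simp
      with le l show False by simp
    qed
    \<comment> \<open>Three vertices have three possible edges, so
      \<open>2 * l + card (E1 \<inter> E2) \<le> 3\<close>.\<close>
    then have l1: "l = 1" and F: "card (E1 \<inter> E2) \<le> 1"
      using le l by (auto simp: possible_edges_3)
    have "card E1 = 1 \<or> card E1 = 2" using E1 F l1 by auto
    with assms(1-3) have "?s \<le> 3"
      unfolding n3 by (intro laplacian_eigenvalues_dist_3) auto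
    then show ?thesis by (simp add: n3 l1)
  qed
qed

end
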